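(* Let $G$ be a finite simple connected graph and $L$ a positive integer such that the system $$s\cdot\chi_C=1\quad\text{for every even cycle } C \text{ of } G \text{ of length}\le L$$ over $\mathbb F_2$, in the unknown $s\in\mathbb F_2^E$, is consistent. Let $W=\operatorname{span}_{\mathbb F_2}\{\chi_C\}$ be the span of these constraint cycles and let $\mathcal F$ be the family of switching classes of signings solving the system. Then the map $\pi\colon W\to\mathbb F_2$, $\pi\bigl(\sum_{C\in S}\chi_C\bigr)=|S|\bmod 2$ (for $S$ a set of constraint cycles), is a well-defined linear form, and for every even $\ell$, $$\mathbb E_{\sigma\in\mathcal F}\,\operatorname{tr}\bigl(A_\sigma^{\ell}\bigr)=\sum_{z\in W}(-1)^{\pi(z)}N_\ell(z),$$ where $\mathbb E_{\sigma\in\mathcal F}$ is the uniform average over $\mathcal F$.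
   Context: $G=(V,E)$. A signing is $\sigma\in\{\pm1\}^E$, encoded by $s\in\mathbb F_2^E$ with $\sigma_e=(-1)^{s_e}$; $A_\sigma$ is the signed adjacency matrix with $uv$ entry $\sigma_{uv}$ if $uv\in E$ and $0$ otherwise. Switching at a vertex negates the signs of all edges at it; it preserves cycle signs and the spectrum of $A_\sigma$, so $\operatorname{tr}(A_\sigma^\ell)$ depends only on the switching class of $\sigma$. $Z(G)\le\mathbb F_2^E$ is the cycle space; the switching class of $\sigma$ corresponds to the linear functional $z\mapsto s\cdot z$ on $Z(G)$. For a cycle $C$, $\chi_C\in\mathbb F_2^E$ is the indicator vector of its edge set; an even cycle is a cycle of even length. For a closed walk $w$ of length $\ell$ (with marked starting vertex and direction), its parity vector is $z(w)\in Z(G)$, with $z(w)_e$ the number of traversals of $e$ modulo $2$. $N_\ell(z)$ is the number of closed walks of length $\ell$ in $G$ with parity vector $z$. *)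

theory Defs
  imports "HOL-Analysis.Analysis" "HOL-Library.Z2"
begin

text \<open>
  A graph has vertex set \<^term>\<open>UNIV :: 'v set\<close> for a finite type \<^typ>\<open>'v\<close> and an edge set
  \<open>E\<close> of two-element vertex sets.  The space \<open>F_2^E\<close> consists of the vectors of type
  \<open>bit ^ 'v set\<close> supported on \<open>E\<close>; its subspaces and spans are those of \<open>bit ^ 'v set\<close>.
\<close>

definition simple_graph :: "'v::finite set set \<Rightarrow> bool" where
  "simple_graph E \<longleftrightarrow> (\<forall>e\<in>E. card e = 2)"

definition connected_graph :: "'v::finite set set \<Rightarrow> bool" where
  "connected_graph E \<longleftrightarrow> (\<forall>u v. (u, v) \<in> {(x, y). {x, y} \<in> E}\<^sup>*)"

definition edge_space :: "'v::finite set set \<Rightarrow> (bit ^ 'v set) set" where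
  "edge_space E = {s. \<forall>e. e \<notin> E \<longrightarrow> s $ e = 0}"

definition edge_dot :: "'v::finite set set \<Rightarrow> bit ^ 'v set \<Rightarrow> bit ^ 'v set \<Rightarrow> bit" where
  "edge_dot E s z = (\<Sum>e\<in>E. s $ e * z $ e)"

definition chi :: "'v::finite set set \<Rightarrow> bit ^ 'v set" where
  "chi C = (\<chi> e. indicator C e)"

definition bit_sign :: "bit \<Rightarrow> real" where
  "bit_sign b = (if b = 1 then -1 else 1)"


text \<open>
  A cycle is identified with its edge set, so its rotations and its reversal are the same cycle
  and its length is the cardinality of that set.
\<close>

definition cycle_edges :: "'v list \<Rightarrow> 'v set set" where
  "cycle_edges xs = {{xs ! i, xs ! (Suc i mod length xs)} | i. i < length xs}"

definition is_cycle :: "'v::finite set set \<Rightarrow> 'v set set \<Rightarrow> bool" where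
  "is_cycle E C \<longleftrightarrow>
     (\<exists>xs. distinct xs \<and> length xs \<ge> 3 \<and> cycle_edges xs \<subseteq> E \<and> C = cycle_edges xs)"

definition constraint_cycles :: "'v::finite set set \<Rightarrow> nat \<Rightarrow> 'v set set set" where
  "constraint_cycles E L = {C. is_cycle E C \<and> even (card C) \<and> card C \<le> L}"

definition solutions :: "'v::finite set set \<Rightarrow> nat \<Rightarrow> (bit ^ 'v set) set" where
  "solutions E L =
     {s \<in> edge_space E. \<forall>C\<in>constraint_cycles E L. edge_dot E s (chi C) = 1}"

definition constraint_span :: "'v::finite set set \<Rightarrow> nat \<Rightarrow> (bit ^ 'v set) set" where
  "constraint_span E L = vec.span (chi ` constraint_cycles E L)"

definition is_constraint_parity ::
    "'v::finite set set \<Rightarrow> nat \<Rightarrow> bit ^ 'v set \<Rightarrow> bit \<Rightarrow> bool" where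
  "is_constraint_parity E L z p \<longleftrightarrow>
     (\<exists>S \<subseteq> constraint_cycles E L. z = (\<Sum>C\<in>S. chi C) \<and> p = of_nat (card S))"

text \<open>
  The form is meaningful at \<open>z\<close> only if exactly one \<open>p\<close> satisfies
  \<^const>\<open>is_constraint_parity\<close>; otherwise its value is unspecified.
\<close>

definition constraint_form :: "'v::finite set set \<Rightarrow> nat \<Rightarrow> bit ^ 'v set \<Rightarrow> bit" where
  "constraint_form E L z = (THE p. is_constraint_parity E L z p)"


definition signings :: "'v::finite set set \<Rightarrow> ('v set \<Rightarrow> real) set" where
  "signings E = E \<rightarrow>\<^sub>E {1, -1}"

definition signing_of :: "'v::finite set set \<Rightarrow> bit ^ 'v set \<Rightarrow> 'v set \<Rightarrow> real" where
  "signing_of E s = (\<lambda>e\<in>E. bit_sign (s $ e))"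

definition switch :: "'v::finite set set \<Rightarrow> 'v \<Rightarrow> ('v set \<Rightarrow> real) \<Rightarrow> 'v set \<Rightarrow> real" where
  "switch E v \<sigma> = (\<lambda>e\<in>E. if v \<in> e then - \<sigma> e else \<sigma> e)"

text \<open>
  Switching twice at the same vertex is the identity on signings, so the reflexive transitive
  closure below is already symmetric.
\<close>

definition switching_rel ::
    "'v::finite set set \<Rightarrow> (('v set \<Rightarrow> real) \<times> ('v set \<Rightarrow> real)) set" where
  "switching_rel E = {(\<sigma>, \<tau>). \<sigma> \<in> signings E \<and> (\<exists>v. \<tau> = switch E v \<sigma>)}\<^sup>*"

definition solution_classes :: "'v::finite set set \<Rightarrow> nat \<Rightarrow> ('v set \<Rightarrow> real) set set" where
  "solution_classes E L = (signing_of E ` solutions E L) // switching_rel E"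

definition signed_adjacency ::
    "'v::finite set set \<Rightarrow> ('v set \<Rightarrow> real) \<Rightarrow> real ^ 'v ^ 'v" where
  "signed_adjacency E \<sigma> = (\<chi> u v. if {u, v} \<in> E then \<sigma> {u, v} else 0)"

definition matrix_power :: "real ^ 'n::finite ^ 'n \<Rightarrow> nat \<Rightarrow> real ^ 'n ^ 'n" where
  "matrix_power A k = (((**) A) ^^ k) (mat 1)"

text \<open>
  The trace is constant on each switching class, and \<^const>\<open>the_elem\<close> picks this common value.
\<close>

definition class_trace ::
    "'v::finite set set \<Rightarrow> nat \<Rightarrow> ('v set \<Rightarrow> real) set \<Rightarrow> real" where
  "class_trace E l K = the_elem ((\<lambda>\<sigma>. trace (matrix_power (signed_adjacency E \<sigma>) l)) ` K)"

definition average :: "'a set \<Rightarrow> ('a \<Rightarrow> real) \<Rightarrow> real" where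
  "average F f = (\<Sum>x\<in>F. f x) / real (card F)"


definition closed_walks :: "'v::finite set set \<Rightarrow> nat \<Rightarrow> 'v list set" where
  "closed_walks E l =
     {w. length w = Suc l \<and> hd w = last w \<and> (\<forall>i<l. {w ! i, w ! Suc i} \<in> E)}"

definition parity_vector :: "'v::finite list \<Rightarrow> bit ^ 'v set" where
  "parity_vector w =
     (\<chi> e. of_nat (card {i. Suc i < length w \<and> {w ! i, w ! Suc i} = e}))"

definition num_closed_walks :: "'v::finite set set \<Rightarrow> nat \<Rightarrow> bit ^ 'v set \<Rightarrow> nat" where
  "num_closed_walks E l z = card {w \<in> closed_walks E l. parity_vector w = z}"

end

theory Submission
  imports Defs
begin

text \<open>
  If \<open>s\<close> solves the system, then \<open>s \<cdot> z\<close> is the parity of every set of constraint cycles summing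
  to \<open>z\<close>, so the form is well defined and equals \<open>z \<mapsto> s \<cdot> z\<close> on \<open>W\<close>.  Expanding the trace over closed
  walks \<open>w\<close> gives the signs \<open>(-1)\<^bsup>s \<cdot> z(w)\<^esup>\<close>.  On \<open>W\<close> such a sign is the same for all solutions; for
  \<open>z(w)\<close> outside \<open>W\<close> there is a vector orthogonal to \<open>W\<close> but not to \<open>z(w)\<close>, and translating the
  solutions by it flips the sign, so the contributions cancel.  Finally, switching classes are cosets
  of the cut space, which is orthogonal to all cycles; hence they partition the solutions into parts
  of equal size, and averaging over classes is averaging over solutions.
\<close>

(* These default rules turn the field operations into bit operations, on which the ring lemmas
   no longer apply. *)
declare add_bit_eq_xor [simp del] mult_bit_eq_and [simp del]

instance bit :: finite
proof
  have "(UNIV :: bit set) \<subseteq> {0, 1}" by auto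
  then show "finite (UNIV :: bit set)" by (rule finite_subset) simp
qed

section \<open>Signs of bits and the pairing on edge vectors\<close>

lemma bit_sign_add: "bit_sign (a + b) = bit_sign a * bit_sign b"
  by (cases a; cases b) (simp_all add: bit_sign_def)

lemma bit_sign_sum: "bit_sign (\<Sum>i\<in>A. f i) = (\<Prod>i\<in>A. bit_sign (f i))"
  by (induction A rule: infinite_finite_induct) (simp_all add: bit_sign_add, simp_all add: bit_sign_def)

lemma bit_vec_add_self: "(x :: bit ^ 'n) + x = 0"
  by (simp add: vec_eq_iff)

text \<open>Every interior term occurs twice and so vanishes in characteristic 2.\<close>

lemma bit_sum_telescope: "(\<Sum>i<n. f i + f (Suc i)) = f 0 + (f n :: bit)"
proof (induction n)
  case (Suc n)
  then show ?case by (cases "f 0"; cases "f n"; cases "f (Suc n)") simp_all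
qed simp

lemma edge_dot_add_left: "edge_dot E (s + t) z = edge_dot E s z + edge_dot E t z"
  by (simp add: edge_dot_def algebra_simps sum.distrib)

lemma edge_dot_add_right: "edge_dot E s (y + z) = edge_dot E s y + edge_dot E s z"
  by (simp add: edge_dot_def algebra_simps sum.distrib)

lemma edge_dot_scale_right: "edge_dot E s (c *s z) = c * edge_dot E s z"
  by (simp add: edge_dot_def sum_distrib_left mult.left_commute)

lemma edge_dot_zero [simp]: "edge_dot E 0 z = 0" "edge_dot E s 0 = 0"
  by (simp_all add: edge_dot_def)

lemma edge_dot_commute: "edge_dot E s z = edge_dot E z s"
  by (simp add: edge_dot_def mult.commute)

lemma edge_dot_sum_right: "edge_dot E s (\<Sum>i\<in>A. f i) = (\<Sum>i\<in>A. edge_dot E s (f i))"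
  by (induction A rule: infinite_finite_induct) (simp_all add: edge_dot_add_right)

lemma edge_dot_eq_0_on_span:
  assumes "z \<in> vec.span X" "\<And>x. x \<in> X \<Longrightarrow> edge_dot E s x = 0"
  shows "edge_dot E s z = 0"
  using assms(1)
  by (induction rule: vec.span_induct_alt)
    (simp_all add: edge_dot_add_right edge_dot_scale_right assms(2))

lemma chi_nth: "chi C $ e = of_bool (e \<in> C)"
  by (simp add: chi_def indicator_def)

lemma edge_dot_chi:
  assumes "C \<subseteq> E"
  shows "edge_dot E s (chi C) = (\<Sum>e\<in>C. s $ e)"
proof -
  have "edge_dot E s (chi C) = (\<Sum>e\<in>E. if e \<in> C then s $ e else 0)"
    unfolding edge_dot_def by (intro sum.cong) (auto simp: chi_nth)
  also have "\<dots> = (\<Sum>e\<in>C. s $ e)"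
    using assms by (simp add: sum.inter_restrict[symmetric] Int_absorb1)
  finally show ?thesis .
qed

lemma edge_space_subspace: "vec.subspace (edge_space E)"
  by (auto simp: vec.subspace_def edge_space_def)

lemma edge_space_add: "s \<in> edge_space E \<Longrightarrow> t \<in> edge_space E \<Longrightarrow> s + t \<in> edge_space E"
  using edge_space_subspace by (rule vec.subspace_add)

lemma chi_in_edge_space: "C \<subseteq> E \<Longrightarrow> chi C \<in> edge_space E"
  by (auto simp: edge_space_def chi_nth)

section \<open>Separation and spans over F_2\<close>

text \<open>A linear functional that kills \<open>X\<close> but not \<open>z\<close> is represented
  by pairing with the vector \<open>t\<close> of its values on the unit vectors.\<close>

lemma edge_space_separation:
  fixes E :: "'v::finite set set"
  assumes "X \<subseteq> edge_space E" "z \<in> edge_space E" "z \<notin> vec.span X"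
  obtains t where "t \<in> edge_space E" "\<And>x. x \<in> X \<Longrightarrow> edge_dot E t x = 0" "edge_dot E t z = 1"
proof -
  obtain B where B: "B \<subseteq> X" "vec.independent B" "X \<subseteq> vec.span B"
    by (rule vec.maximal_independent_subset)
  have zB: "z \<notin> vec.span B"
    using assms(3) vec.span_mono[OF B(1)] by blast
  then have "vec.independent (insert z B)"
    using B(2) vec.span_base[of z B] by (simp add: vec.independent_insert)
  \<comment> \<open>The functional is the \<open>{}\<close> coordinate of a vector-valued map
    \<open>g\<close>; the index \<open>{}\<close> is an arbitrary choice.\<close>
  then obtain g :: "bit ^ 'v set \<Rightarrow> bit ^ 'v set"
    where g: "Vector_Spaces.linear (*s) (*s) g"
      and g_eq: "\<forall>x\<in>insert z B. g x = (if x = z then axis {} 1 else 0)"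
    using vec.linear_independent_extend[of "insert z B" "\<lambda>x. if x = z then axis {} 1 else 0"]
    by blast
  \<comment> \<open>Truncating to \<open>E\<close> puts \<open>t\<close> into the edge space and
    leaves its pairing with edge vectors unchanged.\<close>
  define t :: "bit ^ 'v set" where "t = (\<chi> e. if e \<in> E then g (axis e 1) $ {} else 0)"
  have dot: "edge_dot E t x = g x $ {}" if "x \<in> edge_space E" for x
  proof -
    have "g x $ {} = (\<Sum>e\<in>UNIV. x $ e * g (axis e 1) $ {})"
      by (rule Cartesian_Space.linear_componentwise[OF g])
    also have "\<dots> = (\<Sum>e\<in>E. x $ e * g (axis e 1) $ {})"
      using that by (intro sum.mono_neutral_right) (auto simp: edge_space_def)
    also have "\<dots> = edge_dot E t x"
      unfolding edge_dot_def t_def by (intro sum.cong) (auto simp: mult.commute)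
    finally show ?thesis by simp
  qed
  have "g x = 0" if "x \<in> B" for x
  proof -
    have "x \<noteq> z" using that zB vec.span_base by blast
    then show ?thesis using g_eq that by simp
  qed
  then have g0: "g x = 0" if "x \<in> X" for x
    using B(3) that by (auto intro: vec.linear_eq_0_on_span[OF g])
  show thesis
  proof
    show "t \<in> edge_space E"
      by (simp add: t_def edge_space_def)
    show "edge_dot E t x = 0" if "x \<in> X" for x
      using dot[of x] g0[OF that] that assms(1) by auto
    show "edge_dot E t z = 1"
      using dot[OF assms(2)] g_eq by simp
  qed
qed

text \<open>The only scalars are 0 and 1, and adding a vector whose index is already in
  \<open>S\<close> cancels it, so the index is removed instead.\<close>

lemma bit_span_eq_subset_sums:
  fixes f :: "'a::finite \<Rightarrow> bit ^ 'n"
  assumes "z \<in> vec.span (f ` A)"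
  obtains S where "S \<subseteq> A" "z = (\<Sum>x\<in>S. f x)"
proof -
  have "\<exists>S\<subseteq>A. z = (\<Sum>x\<in>S. f x)"
    using assms
  proof (induction rule: vec.span_induct_alt)
    case base
    show ?case by (intro exI[of _ "{}"]) simp
  next
    case (step c x y)
    then obtain a S where a: "a \<in> A" "x = f a" and S: "S \<subseteq> A" "y = (\<Sum>x\<in>S. f x)"
      by blast
    show ?case
    proof (cases "c = 0")
      case True
      then show ?thesis using S by auto
    next
      case False
      then have c: "c = 1" by simp
      show ?thesis
      proof (cases "a \<in> S")
        case True
        then have "y = f a + (\<Sum>x\<in>S - {a}. f x)"
          using S(2) by (simp add: sum.remove[of S a])
        then have "c *s x + y = (\<Sum>x\<in>S - {a}. f x)"
          by (simp add: a c bit_vec_add_self flip: add.assoc)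
        then show ?thesis using S(1) by (intro exI[of _ "S - {a}"]) auto
      next
        case False
        then show ?thesis using S a c by (intro exI[of _ "insert a S"]) auto
      qed
    qed
  qed
  then show thesis using that by blast
qed

section \<open>The constraint form\<close>

lemma constraint_cycle_subset: "C \<in> constraint_cycles E L \<Longrightarrow> C \<subseteq> E"
  by (auto simp: constraint_cycles_def is_cycle_def)

text \<open>Each constraint cycle in the sum pairs to 1 with \<open>s\<close>, so the pairing counts
  the cycles modulo 2, whichever set \<open>S\<close> was chosen.\<close>

lemma solution_dot_eq_parity:
  assumes "s \<in> solutions E L" "is_constraint_parity E L z p"
  shows "p = edge_dot E s z"
proof -
  obtain S where S: "S \<subseteq> constraint_cycles E L" "z = (\<Sum>C\<in>S. chi C)" "p = of_nat (card S)"
    using assms(2) by (auto simp: is_constraint_parity_def)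
  have "edge_dot E s z = (\<Sum>C\<in>S. 1)"
    unfolding S(2) edge_dot_sum_right
    using assms(1) S(1) by (intro sum.cong) (auto simp: solutions_def)
  then show ?thesis by (simp add: S(3))
qed

lemma constraint_parity_unique:
  assumes "s \<in> solutions E L" "z \<in> constraint_span E L"
  shows "is_constraint_parity E L z p \<longleftrightarrow> p = edge_dot E s z"
proof -
  obtain S where "S \<subseteq> constraint_cycles E L" "z = (\<Sum>C\<in>S. chi C)"
    using assms(2) bit_span_eq_subset_sums unfolding constraint_span_def by metis
  then have "is_constraint_parity E L z (of_nat (card S))"
    by (auto simp: is_constraint_parity_def)
  then show ?thesis
    using solution_dot_eq_parity[OF assms(1)] by metis
qed

lemma constraint_form_eq:
  assumes "s \<in> solutions E L" "z \<in> constraint_span E L"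
  shows "constraint_form E L z = edge_dot E s z"
  unfolding constraint_form_def constraint_parity_unique[OF assms] by simp

text \<open>Orthogonality of characters on the solution set, which is an affine space with direction
  the annihilator of the constraint cycles.\<close>

lemma sum_solutions_bit_sign:
  fixes E :: "'v::finite set set"
  assumes "s\<^sub>0 \<in> solutions E L" "z \<in> edge_space E"
  shows "(\<Sum>s\<in>solutions E L. bit_sign (edge_dot E s z)) =
    (if z \<in> constraint_span E L
     then real (card (solutions E L)) * bit_sign (constraint_form E L z) else 0)"
proof (cases "z \<in> constraint_span E L")
  case True
  then show ?thesis by (simp flip: constraint_form_eq)
next
  case False
  obtain t where t: "t \<in> edge_space E" "\<And>C. C \<in> constraint_cycles E L \<Longrightarrow> edge_dot E t (chi C) = 0"
      "edge_dot E t z = 1"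
    using edge_space_separation[of "chi ` constraint_cycles E L" E z] assms(2) False
      constraint_cycle_subset chi_in_edge_space
    by (metis (no_types, lifting) constraint_span_def image_eqI image_subsetI)
  let ?f = "\<lambda>s. bit_sign (edge_dot E s z)"
  \<comment> \<open>Since \<open>t + t = 0\<close>, translation by \<open>t\<close> is an involution
    of the solution set.\<close>
  have shift: "s + t \<in> solutions E L" if "s \<in> solutions E L" for s
    using that t by (auto simp: solutions_def edge_dot_add_left intro: edge_space_add)
  have "(\<Sum>s\<in>solutions E L. ?f s) = (\<Sum>s\<in>solutions E L. ?f (s + t))"
    by (rule sum.reindex_bij_witness[of _ "\<lambda>s. s + t" "\<lambda>s. s + t"])
      (auto simp: shift add.assoc bit_vec_add_self)
  \<comment> \<open>\<open>t\<close> pairs to 1 with \<open>z\<close>, so each term changes sign; a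
    real sum equal to its negative is 0.\<close>
  also have "\<dots> = - (\<Sum>s\<in>solutions E L. ?f s)"
    by (simp add: edge_dot_add_left bit_sign_add t(3) sum_negf) (simp add: bit_sign_def sum_negf)
  finally show ?thesis using False by simp
qed

section \<open>Traces as sums over closed walks\<close>

lemma finite_lists_length [simp]: "finite {w :: 'a::finite list. length w = n \<and> P w}"
  by (rule finite_subset[OF _ finite_lists_length_eq[of UNIV n]]) auto

text \<open>Powers are built by multiplication on the left, so the induction peels off the first
  vertex. All vertex lists are summed over; non-edges matter only through the entries of
  \<open>A\<close>.\<close>

lemma matrix_power_eq_sum_lists:
  fixes A :: "real ^ 'n::finite ^ 'n"
  shows "matrix_power A k $ u $ v =
    (\<Sum>w | length w = Suc k \<and> hd w = u \<and> last w = v. \<Prod>i<k. A $ (w ! i) $ (w ! Suc i))"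
proof (induction k arbitrary: u)
  case 0
  have "{w. length w = Suc 0 \<and> hd w = u \<and> last w = v} = (if u = v then {[u]} else {})"
    by (auto simp: length_Suc_conv)
  then show ?case by (simp add: matrix_power_def mat_def)
next
  case (Suc k)
  let ?P = "\<lambda>k w. \<Prod>i<k. A $ (w ! i) $ (w ! Suc i)"
  let ?T = "{w. length w = Suc k \<and> last w = v}"
  have "matrix_power A (Suc k) $ u $ v = (\<Sum>x\<in>UNIV. A $ u $ x * matrix_power A k $ x $ v)"
    by (simp add: matrix_power_def matrix_matrix_mult_def)
  also have "\<dots> = (\<Sum>x\<in>UNIV. \<Sum>w | w \<in> ?T \<and> hd w = x. A $ u $ hd w * ?P k w)"
    unfolding Suc.IH sum_distrib_left by (intro sum.cong) auto
  also have "\<dots> = (\<Sum>w\<in>?T. A $ u $ hd w * ?P k w)"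
    by (rule sum.group) auto
  also have "\<dots> = (\<Sum>w | length w = Suc (Suc k) \<and> hd w = u \<and> last w = v. ?P (Suc k) w)"
  \<comment> \<open>Prepending \<open>u\<close> and dropping the head are mutually inverse; the
    factor \<open>A $ u $ hd w\<close> is the new first step.\<close>
  proof (rule sum.reindex_bij_witness[of _ tl "(#) u"])
    fix w assume "w \<in> ?T"
    then obtain x xs where "w = x # xs" by (cases w) auto
    then show "?P (Suc k) (u # w) = A $ u $ hd w * ?P k w"
      by (simp only: prod.lessThan_Suc_shift) simp
  qed (auto simp: length_Suc_conv)
  finally show ?case .
qed

lemma closed_walks_length: "w \<in> closed_walks E l \<Longrightarrow> length w = Suc l"
  by (simp add: closed_walks_def)

lemma finite_closed_walks: "finite (closed_walks E l)"
  unfolding closed_walks_def by simp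

lemma trace_matrix_power_signed_adjacency:
  "trace (matrix_power (signed_adjacency E \<sigma>) l) =
    (\<Sum>w\<in>closed_walks E l. \<Prod>i<l. \<sigma> {w ! i, w ! Suc i})"
proof -
  let ?P = "\<lambda>w. \<Prod>i<l. signed_adjacency E \<sigma> $ (w ! i) $ (w ! Suc i)"
  let ?T = "{w. length w = Suc l \<and> hd w = last w}"
  have "trace (matrix_power (signed_adjacency E \<sigma>) l) = (\<Sum>u\<in>UNIV. \<Sum>w | w \<in> ?T \<and> hd w = u. ?P w)"
    unfolding trace_def matrix_power_eq_sum_lists by (intro sum.cong) auto
  also have "\<dots> = (\<Sum>w\<in>?T. ?P w)"
    by (rule sum.group) auto
  \<comment> \<open>A list with a step outside \<open>E\<close> has a zero factor.\<close>
  also have "\<dots> = (\<Sum>w\<in>closed_walks E l. ?P w)"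
    by (rule sum.mono_neutral_right)
      (auto simp: closed_walks_def signed_adjacency_def intro!: prod_zero)
  also have "\<dots> = (\<Sum>w\<in>closed_walks E l. \<Prod>i<l. \<sigma> {w ! i, w ! Suc i})"
    by (intro sum.cong prod.cong) (auto simp: closed_walks_def signed_adjacency_def)
  finally show ?thesis .
qed

text \<open>Double counting: the positions of the walk are grouped by the edge traversed
  there.\<close>

lemma edge_dot_parity_vector:
  assumes "w \<in> closed_walks E l"
  shows "edge_dot E s (parity_vector w) = (\<Sum>i<l. s $ {w ! i, w ! Suc i})"
proof -
  let ?e = "\<lambda>i. {w ! i, w ! Suc i}"
  have "edge_dot E s (parity_vector w) = (\<Sum>e\<in>E. \<Sum>i | i \<in> {..<l} \<and> ?e i = e. s $ ?e i)"
    unfolding edge_dot_def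
    by (intro sum.cong)
      (simp_all add: parity_vector_def closed_walks_length[OF assms] mult.commute)
  also have "\<dots> = (\<Sum>i<l. s $ ?e i)"
    using assms by (intro sum.group) (auto simp: closed_walks_def)
  finally show ?thesis .
qed

lemma parity_vector_in_edge_space:
  assumes "w \<in> closed_walks E l"
  shows "parity_vector w \<in> edge_space E"
proof -
  have "{i. Suc i < length w \<and> {w ! i, w ! Suc i} = e} = {}" if "e \<notin> E" for e
    using assms that by (auto simp: closed_walks_def)
  then show ?thesis by (simp add: edge_space_def parity_vector_def del: Collect_empty_eq)
qed

lemma trace_signing_of:
  "trace (matrix_power (signed_adjacency E (signing_of E s)) l) =
    (\<Sum>w\<in>closed_walks E l. bit_sign (edge_dot E s (parity_vector w)))"
  unfolding trace_matrix_power_signed_adjacency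
proof (rule sum.cong)
  fix w assume w: "w \<in> closed_walks E l"
  show "(\<Prod>i<l. signing_of E s {w ! i, w ! Suc i}) = bit_sign (edge_dot E s (parity_vector w))"
    unfolding edge_dot_parity_vector[OF w] bit_sign_sum
    using w by (intro prod.cong) (auto simp: signing_of_def closed_walks_def)
qed simp

section \<open>Switching classes as cosets of the cut space\<close>

text \<open>Adding this vector to \<open>s\<close> encodes switching at \<open>v\<close>.\<close>

definition star :: "'v::finite set set \<Rightarrow> 'v \<Rightarrow> bit ^ 'v set" where
  "star E v = chi {e\<in>E. v \<in> e}"

text \<open>In a simple graph the stars of the vertices in a set \<open>U\<close> sum to the edges
  leaving \<open>U\<close>, so this span consists of the edge cuts.\<close>

definition cut_space :: "'v::finite set set \<Rightarrow> (bit ^ 'v set) set" where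
  "cut_space E = vec.span (range (star E))"

lemma star_nth: "e \<in> E \<Longrightarrow> star E v $ e = of_bool (v \<in> e)"
  by (simp add: star_def chi_nth)

lemma star_in_edge_space: "star E v \<in> edge_space E"
  unfolding star_def by (rule chi_in_edge_space) auto

lemma cut_space_subset: "cut_space E \<subseteq> edge_space E"
  unfolding cut_space_def
  by (intro vec.span_minimal edge_space_subspace) (auto intro: star_in_edge_space)

lemma simple_graph_edge_neq: "simple_graph E \<Longrightarrow> {u, v} \<in> E \<Longrightarrow> u \<noteq> v"
  by (auto simp: simple_graph_def)

text \<open>Without loops, a step uses an edge at \<open>v\<close> exactly when one of its two ends
  is \<open>v\<close>. The end indicators telescope modulo 2 to those of the first and last vertex,
  which coincide.\<close>

lemma star_dot_closed_walk:
  assumes "simple_graph E" "w \<in> closed_walks E l"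
  shows "edge_dot E (star E v) (parity_vector w) = 0"
proof -
  have "edge_dot E (star E v) (parity_vector w) =
      (\<Sum>i<l. of_bool (w ! i = v) + of_bool (w ! Suc i = v))"
    unfolding edge_dot_parity_vector[OF assms(2)]
  proof (rule sum.cong)
    fix i assume "i \<in> {..<l}"
    then have "{w ! i, w ! Suc i} \<in> E"
      using assms(2) by (simp add: closed_walks_def)
    moreover from this have "w ! i \<noteq> w ! Suc i"
      by (rule simple_graph_edge_neq[OF assms(1)])
    ultimately show "star E v $ {w ! i, w ! Suc i} = of_bool (w ! i = v) + of_bool (w ! Suc i = v)"
      by (auto simp: star_nth)
  qed simp
  also have "\<dots> = of_bool (w ! 0 = v) + of_bool (w ! l = v)"
    by (rule bit_sum_telescope)
  also have "w ! l = w ! 0"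
  proof -
    have w: "length w = Suc l" "hd w = last w"
      using assms(2) by (simp_all add: closed_walks_def)
    then have "w \<noteq> []" by auto
    then show ?thesis
      using w by (simp add: hd_conv_nth last_conv_nth)
  qed
  finally show ?thesis by simp
qed

text \<open>Two positions with the same edge either agree or traverse it in opposite directions; the
  latter would make 2 vanish modulo the length, which is at least 3.\<close>

lemma inj_on_cycle_edge:
  assumes "distinct xs" "length xs \<ge> 3"
  shows "inj_on (\<lambda>i. {xs ! i, xs ! (Suc i mod length xs)}) {..<length xs}"
proof (rule inj_onI)
  let ?n = "length xs"
  fix i j assume ij: "i \<in> {..<?n}" "j \<in> {..<?n}"
    and eq: "{xs ! i, xs ! (Suc i mod ?n)} = {xs ! j, xs ! (Suc j mod ?n)}"
  have lt: "i < ?n" "j < ?n" "Suc i mod ?n < ?n" "Suc j mod ?n < ?n"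
    using ij assms(2) by (auto intro!: mod_less_divisor)
  have "i = j \<or> (i = Suc j mod ?n \<and> Suc i mod ?n = j)"
    using eq lt assms(1) by (auto simp: doubleton_eq_iff nth_eq_iff_index_eq)
  then show "i = j"
    using lt assms(2) by (auto simp: mod_Suc split: if_splits)
qed

text \<open>The indicator of \<open>v\<close> is summed over both ends of every edge. The cyclic
  shift permutes the positions, so both sums agree and cancel modulo 2.\<close>

lemma star_dot_cycle:
  assumes "is_cycle E C"
  shows "edge_dot E (star E v) (chi C) = 0"
proof -
  obtain xs where xs: "distinct xs" "length xs \<ge> 3" "C \<subseteq> E" "C = cycle_edges xs"
    using assms by (auto simp: is_cycle_def)
  let ?n = "length xs"
  let ?b = "\<lambda>i. of_bool (xs ! i = v) :: bit"
  have C: "C = (\<lambda>i. {xs ! i, xs ! (Suc i mod ?n)}) ` {..<?n}"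
    by (auto simp: xs(4) cycle_edges_def)
  have "edge_dot E (star E v) (chi C) = (\<Sum>e\<in>C. of_bool (v \<in> e))"
    unfolding edge_dot_chi[OF xs(3)] using xs(3) by (intro sum.cong) (auto simp: star_nth)
  also have "\<dots> = (\<Sum>i<?n. of_bool (v \<in> {xs ! i, xs ! (Suc i mod ?n)}))"
    unfolding C by (subst sum.reindex[OF inj_on_cycle_edge[OF xs(1,2)]]) simp
  also have "\<dots> = (\<Sum>i<?n. ?b i + ?b (Suc i mod ?n))"
  proof (rule sum.cong)
    fix i assume i: "i \<in> {..<?n}"
    then have "i \<noteq> Suc i mod ?n"
      using xs(2) by (auto simp: mod_Suc)
    moreover have "Suc i mod ?n < ?n" using xs(2) by (intro mod_less_divisor) linarith
    ultimately have "xs ! i \<noteq> xs ! (Suc i mod ?n)"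
      using i xs(1) by (auto simp: nth_eq_iff_index_eq)
    then show "of_bool (v \<in> {xs ! i, xs ! (Suc i mod ?n)}) = ?b i + ?b (Suc i mod ?n)"
      by auto
  qed simp
  also have "\<dots> = (\<Sum>i<?n. ?b i) + (\<Sum>i<?n. ?b (Suc i mod ?n))"
    by (rule sum.distrib)
  also have "(\<Sum>i<?n. ?b (Suc i mod ?n)) = (\<Sum>i<?n. ?b i)"
  proof -
    obtain m where m: "?n = Suc m" using xs(2) by (cases ?n) auto
    \<comment> \<open>The last position \<open>m\<close> wraps around to 0.\<close>
    have "(\<Sum>i<?n. ?b (Suc i mod ?n)) = (\<Sum>i<m. ?b (Suc i)) + ?b 0"
      by (simp add: m)
    also have "\<dots> = (\<Sum>i<?n. ?b i)"
      unfolding m sum.lessThan_Suc_shift by (simp add: add.commute)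
    finally show ?thesis .
  qed
  finally show ?thesis by simp
qed

lemma cut_dot_eq_0:
  assumes "c \<in> cut_space E" "\<And>v. edge_dot E (star E v) z = 0"
  shows "edge_dot E c z = 0"
proof -
  \<comment> \<open>The pairing is symmetric, so \<open>c\<close> can be moved to the argument in
    which spans are handled.\<close>
  have "edge_dot E z c = 0"
    using assms(1) unfolding cut_space_def
  proof (rule edge_dot_eq_0_on_span)
    fix x assume "x \<in> range (star E)"
    then obtain v where "x = star E v" by blast
    then show "edge_dot E z x = 0"
      using assms(2)[of v] edge_dot_commute[of E z x] by simp
  qed
  then show ?thesis by (simp only: edge_dot_commute[of E c z])
qed

lemma cut_dot_closed_walk:
  assumes "simple_graph E" "w \<in> closed_walks E l" "c \<in> cut_space E"
  shows "edge_dot E c (parity_vector w) = 0"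
  using assms(3) star_dot_closed_walk[OF assms(1,2)] by (rule cut_dot_eq_0)

text \<open>Cuts are orthogonal to all cycles, so the solution set is a union of cosets of the cut
  space.\<close>

lemma solutions_add_cut:
  assumes "s \<in> solutions E L" "c \<in> cut_space E"
  shows "s + c \<in> solutions E L"
proof -
  have "edge_dot E c (chi C) = 0" if "C \<in> constraint_cycles E L" for C
    using assms(2) star_dot_cycle
  proof (rule cut_dot_eq_0)
    show "is_cycle E C" using that by (simp add: constraint_cycles_def)
  qed
  then show ?thesis
    using assms cut_space_subset by (auto simp: solutions_def edge_dot_add_left intro: edge_space_add)
qed

lemma inj_on_signing_of: "inj_on (signing_of E) (edge_space E)"
proof (rule inj_onI)
  fix s t assume st: "s \<in> edge_space E" "t \<in> edge_space E" and eq: "signing_of E s = signing_of E t"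
  have "s $ e = t $ e" for e
  proof (cases "e \<in> E")
    case True
    then have "bit_sign (s $ e) = bit_sign (t $ e)"
      using fun_cong[OF eq, of e] by (simp add: signing_of_def)
    then show ?thesis
      by (cases "s $ e"; cases "t $ e") (simp_all add: bit_sign_def)
  next
    case False
    then show ?thesis using st by (simp add: edge_space_def)
  qed
  then show "s = t" by (simp add: vec_eq_iff)
qed

lemma signing_of_in_signings: "signing_of E s \<in> signings E"
  by (auto simp: signing_of_def signings_def bit_sign_def)

lemma switch_signing_of: "switch E v (signing_of E s) = signing_of E (s + star E v)"
proof
  fix e
  show "switch E v (signing_of E s) e = signing_of E (s + star E v) e"
    by (simp add: switch_def signing_of_def star_nth bit_sign_add) (simp add: bit_sign_def)
qed

text \<open>Each switching adds one star. One inclusion is by induction on the sequence of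
  switchings, the other by induction on the span.\<close>

lemma switching_class_eq:
  "switching_rel E `` {signing_of E s} = signing_of E ` ((+) s ` cut_space E)"
proof (intro equalityI subsetI)
  fix \<tau> assume "\<tau> \<in> switching_rel E `` {signing_of E s}"
  then have "(signing_of E s, \<tau>) \<in> switching_rel E" by simp
  then show "\<tau> \<in> signing_of E ` ((+) s ` cut_space E)"
    unfolding switching_rel_def
  proof (induction rule: rtrancl_induct)
    case base
    have "0 \<in> cut_space E" by (simp add: cut_space_def vec.span_zero)
    then show ?case by force
  next
    case (step \<sigma> \<tau>)
    then obtain c v where c: "c \<in> cut_space E" "\<sigma> = signing_of E (s + c)" "\<tau> = switch E v \<sigma>"
      by auto
    then have "\<tau> = signing_of E (s + (c + star E v))"
      by (simp add: switch_signing_of add.assoc)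
    moreover have "c + star E v \<in> cut_space E"
      using c(1) unfolding cut_space_def by (simp add: vec.span_add vec.span_base)
    ultimately show ?case by blast
  qed
next
  fix \<tau> assume "\<tau> \<in> signing_of E ` ((+) s ` cut_space E)"
  then obtain c where c: "c \<in> cut_space E" "\<tau> = signing_of E (s + c)" by auto
  have "(signing_of E s, signing_of E (s + c)) \<in> switching_rel E"
    using c(1) unfolding cut_space_def
  proof (induction rule: vec.span_induct_alt)
    case base
    show ?case by (simp add: switching_rel_def)
  next
    case (step a x y)
    then obtain v where x: "x = star E v" by auto
    show ?case
    proof (cases "a = 0")
      case True
      then show ?thesis using step by simp
    next
      case False
      \<comment> \<open>A nonzero scalar is 1, so this summand is one more switching.\<close>
      then have "signing_of E (s + (a *s x + y)) = switch E v (signing_of E (s + y))"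
        by (simp add: switch_signing_of x ac_simps)
      then show ?thesis
        using step(2) unfolding switching_rel_def
        by (auto intro: rtrancl_into_rtrancl signing_of_in_signings)
    qed
  qed
  then show "\<tau> \<in> switching_rel E `` {signing_of E s}" using c(2) by simp
qed

text \<open>\<open>signing_of\<close> is injective on the edge space, so equality of classes is
  equality of cosets.\<close>

lemma switching_class_eq_iff:
  assumes "s \<in> edge_space E" "t \<in> edge_space E"
  shows "switching_rel E `` {signing_of E s} = switching_rel E `` {signing_of E t} \<longleftrightarrow>
    t \<in> (+) s ` cut_space E"
proof -
  have sub: "(+) r ` cut_space E \<subseteq> edge_space E" if "r \<in> edge_space E" for r
    using that cut_space_subset by (auto intro: edge_space_add)
  have "switching_rel E `` {signing_of E s} = switching_rel E `` {signing_of E t} \<longleftrightarrow>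
      (+) s ` cut_space E = (+) t ` cut_space E"
    unfolding switching_class_eq
    by (rule inj_on_image_eq_iff[OF inj_on_signing_of sub[OF assms(1)] sub[OF assms(2)]])
  also have "\<dots> \<longleftrightarrow> t \<in> (+) s ` cut_space E"
  proof
    assume "(+) s ` cut_space E = (+) t ` cut_space E"
    moreover have "t + 0 \<in> (+) t ` cut_space E"
      by (intro imageI) (simp add: cut_space_def vec.span_zero)
    ultimately show "t \<in> (+) s ` cut_space E" by simp
  next
    assume "t \<in> (+) s ` cut_space E"
    then obtain c where c: "c \<in> cut_space E" "t = s + c" by auto
    have add: "c + d \<in> cut_space E" if "d \<in> cut_space E" for d
      using c(1) that unfolding cut_space_def by (rule vec.span_add)
    have "c + (c + d) = d" for d
      by (simp add: bit_vec_add_self flip: add.assoc)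
    then have "s + d = t + (c + d)" "t + d = s + (c + d)" for d
      by (simp_all add: c(2) add.assoc)
    then show "(+) s ` cut_space E = (+) t ` cut_space E"
      using add by (intro equalityI image_subsetI; metis imageI)
  qed
  finally show ?thesis .
qed

text \<open>Cut vectors pair to 0 with parity vectors of closed walks, so every sign in the walk
  expansion is constant on the class. The image under the trace is thus a singleton, as
  \<open>the_elem\<close> requires.\<close>

lemma class_trace_eq:
  assumes "simple_graph E"
  shows "class_trace E l (switching_rel E `` {signing_of E s}) =
    trace (matrix_power (signed_adjacency E (signing_of E s)) l)"
proof -
  let ?tr = "\<lambda>\<sigma>. trace (matrix_power (signed_adjacency E \<sigma>) l)"
  have "?tr (signing_of E (s + c)) = ?tr (signing_of E s)" if "c \<in> cut_space E" for c
    unfolding trace_signing_of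
    using that by (intro sum.cong) (simp_all add: edge_dot_add_left cut_dot_closed_walk[OF assms])
  moreover have "cut_space E \<noteq> {}"
    unfolding cut_space_def using vec.span_zero by blast
  ultimately have "?tr ` (switching_rel E `` {signing_of E s}) = {?tr (signing_of E s)}"
    unfolding switching_class_eq by (auto simp: image_image image_iff)
  then show ?thesis by (simp add: class_trace_def)
qed

section \<open>Averaging over switching classes\<close>

lemma average_image_eq_fibers:
  assumes "finite A" "k > 0" "\<And>b. b \<in> g ` A \<Longrightarrow> card {a\<in>A. g a = b} = k"
  shows "average (g ` A) f = average A (\<lambda>a. f (g a))"
proof -
  have "(\<Sum>a\<in>A. h (g a)) = real k * (\<Sum>b\<in>g ` A. h b)" for h :: "_ \<Rightarrow> real"
  proof -
    have "(\<Sum>a\<in>A. h (g a)) = (\<Sum>b\<in>g ` A. \<Sum>a | a \<in> A \<and> g a = b. h (g a))"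
      using assms(1) by (intro sum.group[symmetric]) auto
    also have "\<dots> = (\<Sum>b\<in>g ` A. real k * h b)"
      using assms(3) by (intro sum.cong) auto
    finally show ?thesis by (simp add: sum_distrib_left)
  qed
  \<comment> \<open>The constant function 1 gives \<open>card A\<close> as \<open>k\<close> times
    the size of the image, so \<open>k\<close> cancels in the quotient.\<close>
  from this[of f] this[of "\<lambda>_. 1"] show ?thesis
    using assms(2) by (simp add: average_def)
qed

text \<open>The solutions in a given class form a full coset of the cut space, so all fibers have
  the same size.\<close>

lemma average_solution_classes:
  fixes E :: "'v::finite set set"
  shows "average (solution_classes E L) f =
    average (solutions E L) (\<lambda>s. f (switching_rel E `` {signing_of E s}))"
proof -
  let ?g = "\<lambda>s. switching_rel E `` {signing_of E s}"
  have sol: "solutions E L \<subseteq> edge_space E" by (auto simp: solutions_def)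
  have classes: "solution_classes E L = ?g ` solutions E L"
    by (auto simp: solution_classes_def quotient_def)
  show ?thesis
    unfolding classes
  proof (rule average_image_eq_fibers)
    show "card (cut_space E) > 0"
      using vec.span_zero by (auto simp: card_gt_0_iff cut_space_def)
    fix K assume "K \<in> ?g ` solutions E L"
    then obtain s where s: "s \<in> solutions E L" "K = ?g s" by auto
    have "{t \<in> solutions E L. ?g t = K} = (+) s ` cut_space E"
      using switching_class_eq_iff[of s E] s sol solutions_add_cut[OF s(1)] by blast
    then show "card {t \<in> solutions E L. ?g t = K} = card (cut_space E)"
      by (simp add: card_image)
  qed simp
qed

lemma average_class_trace:
  fixes E :: "'v::finite set set"
  assumes "simple_graph E" "solutions E L \<noteq> {}"
  shows "average (solution_classes E L) (class_trace E l) =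
    (\<Sum>z\<in>constraint_span E L. bit_sign (constraint_form E L z) * real (num_closed_walks E l z))"
proof -
  let ?S = "solutions E L" and ?W = "constraint_span E L"
  obtain s\<^sub>0 where s0: "s\<^sub>0 \<in> ?S" using assms(2) by blast
  let ?g = "\<lambda>z. bit_sign (constraint_form E L z)"
  let ?D = "{w \<in> closed_walks E l. parity_vector w \<in> ?W}"
  have "(\<Sum>s\<in>?S. \<Sum>w\<in>closed_walks E l. bit_sign (edge_dot E s (parity_vector w))) =
      (\<Sum>w\<in>closed_walks E l. if parity_vector w \<in> ?W then card ?S * ?g (parity_vector w) else 0)"
    by (subst sum.swap)
      (intro sum.cong refl sum_solutions_bit_sign[OF s0] parity_vector_in_edge_space)
  also have "\<dots> = card ?S * (\<Sum>w\<in>?D. ?g (parity_vector w))"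
    by (simp add: sum.inter_filter[OF finite_closed_walks] sum_distrib_left if_distrib cong: if_cong)
  \<comment> \<open>Walks are regrouped by parity vector; each group has constant sign and size
    \<open>num_closed_walks E l z\<close>.\<close>
  also have "(\<Sum>w\<in>?D. ?g (parity_vector w)) =
      (\<Sum>z\<in>?W. \<Sum>w | w \<in> ?D \<and> parity_vector w = z. ?g (parity_vector w))"
    by (intro sum.group[symmetric]) (auto simp: finite_closed_walks)
  also have "\<dots> = (\<Sum>z\<in>?W. ?g z * real (num_closed_walks E l z))"
  proof (rule sum.cong)
    fix z assume "z \<in> ?W"
    then have "{w. w \<in> ?D \<and> parity_vector w = z} = {w \<in> closed_walks E l. parity_vector w = z}"
      by auto
    then show "(\<Sum>w | w \<in> ?D \<and> parity_vector w = z. ?g (parity_vector w)) =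
        ?g z * real (num_closed_walks E l z)"
      by (simp add: num_closed_walks_def)
  qed simp
  finally show ?thesis
    unfolding average_solution_classes class_trace_eq[OF assms(1)] trace_signing_of
    using assms(2) by (simp add: average_def)
qed

theorem proposition7:
  fixes E :: "'v::finite set set" and L :: nat
  assumes "simple_graph E"
    and "connected_graph E"
    and "L > 0"
    and "solutions E L \<noteq> {}"
  shows "(\<forall>z\<in>constraint_span E L. \<exists>!p. is_constraint_parity E L z p)
    \<and> (\<forall>x\<in>constraint_span E L. \<forall>y\<in>constraint_span E L.
         constraint_form E L (x + y) = constraint_form E L x + constraint_form E L y)
    \<and> (\<forall>c. \<forall>x\<in>constraint_span E L.
         constraint_form E L (c *s x) = c * constraint_form E L x)
    \<and> (\<forall>l. even l \<longrightarrow>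
         average (solution_classes E L) (class_trace E l) =
           (\<Sum>z\<in>constraint_span E L.
              bit_sign (constraint_form E L z) * real (num_closed_walks E l z)))"
proof -
  obtain s where s: "s \<in> solutions E L" using assms(4) by blast
  \<comment> \<open>Closure of the span lets the representation of the form by \<open>s\<close> be
    applied at sums and multiples too, so linearity is that of the pairing.\<close>
  have closed: "x + y \<in> constraint_span E L" "c *s x \<in> constraint_span E L"
    if "x \<in> constraint_span E L" "y \<in> constraint_span E L" for x y c
    using that unfolding constraint_span_def by (auto intro: vec.span_add vec.span_scale)
  show ?thesis
    using average_class_trace[OF assms(1,4)] closed
    by (simp add: constraint_parity_unique[OF s] constraint_form_eq[OF s] edge_dot_add_right
        edge_dot_scale_right)
qed

end
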